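(* Let $(X_t)_{t\ge0}$ be a regular non-explosive birth–death process on $E=\mathbb{N}$ or $E=\{0,1,\dots,n\}$ with birth rates $(\lambda_x)_{x\in E}$, death rates $(\nu_x)_{x\in E}$, and stationary distribution $\pi\in\mathscr{P}_1(E)$, where $E$ carries the metric $d(x,y)=|x-y|$. Assume that there exists a real number $K$ such that $$\inf_{x\in E\setminus\{0\}}\big(\lambda_{x-1}-\lambda_x+\nu_x-\nu_{x-1}\big)\ge K.$$ Then the $d$-Wasserstein curvature of $(X_t)_{t\ge0}$ is bounded below by $K$, i.e. $\|P_tf\|_{\mathrm{Lip}_d}\le e^{-Kt}\|f\|_{\mathrm{Lip}_d}$ for every $f\in\mathrm{Lip}_d(E)$ and every $t>0$.
   Context: Here $\mathbb{N}=\{0,1,2,\dots\}$. The birth–death process has generator $\mathcal{L}f(x)=\lambda_x(f(x+1)-f(x))+\nu_x(f(x-1)-f(x))$, $x\in E$, where the rates $\lambda_x,\nu_x$ are positive except that $\nu_0=0$ and, if $E=\{0,1,\dots,n\}$, also $\lambda_n=0$. Regular means that the rates determine the process uniquely. $P_tf(x)=\mathbb{E}[f(X_t)\mid X_0=x]$ is its semigroup. $\mathrm{Lip}_d(E)$ is the space of $f:E\to\mathbb{R}$ with $\|f\|_{\mathrm{Lip}_d}:=\sup_{x\ne y}|f(x)-f(y)|/|x-y|<+\infty$. $\mathscr{P}_1(E)$ is the set of probability measures $\mu$ on $E$ with $\sum_{y\in E}d(y,z)\mu(y)<+\infty$ for some $z\in E$; since $\pi\in\mathscr{P}_1(E)$,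 each kernel $P_t(x,\cdot)$ lies in $\mathscr{P}_1(E)$ and $P_tf$ is well defined for $f\in\mathrm{Lip}_d(E)$. *)

theory Defs
  imports "HOL-Probability.Probability"
begin

text \<open>
  The state space is a set \<open>E\<close> of natural numbers; functions on \<open>E\<close> are functions on
  \<^typ>\<open>nat\<close> whose values outside \<open>E\<close> play no role.
\<close>

section \<open>Lipschitz functions, measures with finite first moment, curvature\<close>

definition nat_dist :: "nat \<Rightarrow> nat \<Rightarrow> real" where
  "nat_dist x y = \<bar>real x - real y\<bar>"

definition lip_norm :: "('a \<Rightarrow> 'a \<Rightarrow> real) \<Rightarrow> 'a set \<Rightarrow> ('a \<Rightarrow> real) \<Rightarrow> ennreal" where
  "lip_norm d E f =
     (SUP (x, y)\<in>{(x, y). x \<in> E \<and> y \<in> E \<and> x \<noteq> y}. ennreal (\<bar>f x - f y\<bar> / d x y))"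

definition Lip :: "('a \<Rightarrow> 'a \<Rightarrow> real) \<Rightarrow> 'a set \<Rightarrow> ('a \<Rightarrow> real) set" where
  "Lip d E = {f. lip_norm d E f < \<infinity>}"

text \<open>For countable \<open>E\<close>, probability measures on \<open>E\<close> are mass functions.\<close>

definition finite_first_moment :: "('a \<Rightarrow> 'a \<Rightarrow> real) \<Rightarrow> 'a set \<Rightarrow> 'a pmf set" where
  "finite_first_moment d E =
     {\<mu>. set_pmf \<mu> \<subseteq> E \<and> (\<exists>z\<in>E. (\<lambda>y. d y z * pmf \<mu> y) summable_on E)}"

definition wasserstein_curvature_ge ::
    "('a \<Rightarrow> 'a \<Rightarrow> real) \<Rightarrow> 'a set \<Rightarrow> (real \<Rightarrow> ('a \<Rightarrow> real) \<Rightarrow> 'a \<Rightarrow> real) \<Rightarrow> real \<Rightarrow> bool" where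
  "wasserstein_curvature_ge d E P K \<longleftrightarrow>
     (\<forall>f\<in>Lip d E. \<forall>t>0. lip_norm d E (P t f) \<le> ennreal (exp (- K * t)) * lip_norm d E f)"


section \<open>Birth--death rates\<close>

text \<open>
  The truncated difference \<open>0 - 1 = 0\<close> and values of \<open>f\<close> outside \<open>E\<close> are harmless in the
  generator, since the corresponding rates vanish.
\<close>

definition bd_generator ::
    "(nat \<Rightarrow> real) \<Rightarrow> (nat \<Rightarrow> real) \<Rightarrow> (nat \<Rightarrow> real) \<Rightarrow> nat \<Rightarrow> real" where
  "bd_generator lam nu f x = lam x * (f (x + 1) - f x) + nu x * (f (x - 1) - f x)"

locale birth_death_rates =
  fixes E :: "nat set" and lam nu :: "nat \<Rightarrow> real"
  assumes state_space: "E = UNIV \<or> (\<exists>n. E = {0..n})"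
    and birth_pos: "\<lbrakk>x \<in> E; x + 1 \<in> E\<rbrakk> \<Longrightarrow> 0 < lam x"
    and birth_top: "\<lbrakk>x \<in> E; x + 1 \<notin> E\<rbrakk> \<Longrightarrow> lam x = 0"
    and death_pos: "\<lbrakk>x \<in> E; x \<noteq> 0\<rbrakk> \<Longrightarrow> 0 < nu x"
    and death_0: "nu 0 = 0"

text \<open>
  Regularity: there is at most one honest Markov transition function on \<open>E\<close> whose generator,
  as the pointwise derivative at \<open>0\<close> on bounded functions, is the birth--death generator.
  (Existence is not part of the definition; in use it comes with the process itself.)
  Uniqueness of the law is expressed through the transition function since one cannot quantify
  over the types of the underlying probability spaces.
\<close>

definition bd_transition_function ::
    "nat set \<Rightarrow> (nat \<Rightarrow> real) \<Rightarrow> (nat \<Rightarrow> real) \<Rightarrow> (real \<Rightarrow> nat \<Rightarrow> nat pmf) \<Rightarrow> bool" where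
  "bd_transition_function E lam nu p \<longleftrightarrow>
     (\<forall>t\<ge>0. \<forall>x\<in>E. set_pmf (p t x) \<subseteq> E) \<and>
     (\<forall>x\<in>E. p 0 x = return_pmf x) \<and>
     (\<forall>s\<ge>0. \<forall>t\<ge>0. \<forall>x\<in>E. p (s + t) x = bind_pmf (p s x) (p t)) \<and>
     (\<forall>f. bounded (f ` E) \<longrightarrow> (\<forall>x\<in>E.
        ((\<lambda>h. (measure_pmf.expectation (p h x) f - f x) / h) \<longlongrightarrow> bd_generator lam nu f x)
          (at_right 0)))"

definition regular_rates :: "nat set \<Rightarrow> (nat \<Rightarrow> real) \<Rightarrow> (nat \<Rightarrow> real) \<Rightarrow> bool" where
  "regular_rates E lam nu \<longleftrightarrow>
     (\<forall>p q. bd_transition_function E lam nu p \<longrightarrow> bd_transition_function E lam nu q \<longrightarrow>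
        (\<forall>t\<ge>0. \<forall>x\<in>E. p t x = q t x))"


section \<open>Birth--death processes\<close>

text \<open>
  A process started from every state: \<open>M x\<close> is the law on the common sample space under which
  \<open>X 0 = x\<close>. Only times \<open>t \<ge> 0\<close> and indices \<open>x \<in> E\<close> matter.
\<close>

definition transition_prob ::
    "(nat \<Rightarrow> 'w measure) \<Rightarrow> (real \<Rightarrow> 'w \<Rightarrow> nat) \<Rightarrow> real \<Rightarrow> nat \<Rightarrow> nat \<Rightarrow> real" where
  "transition_prob M X t x y = measure (M x) {w \<in> space (M x). X t w = y}"

definition semigroup_of ::
    "(nat \<Rightarrow> 'w measure) \<Rightarrow> (real \<Rightarrow> 'w \<Rightarrow> nat) \<Rightarrow> real \<Rightarrow> (nat \<Rightarrow> real) \<Rightarrow> nat \<Rightarrow> real" where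
  "semigroup_of M X t f x = (\<integral>w. f (X t w) \<partial>M x)"

definition history :: "'w measure \<Rightarrow> (real \<Rightarrow> 'w \<Rightarrow> nat) \<Rightarrow> real \<Rightarrow> 'w measure" where
  "history N X t = sigma (space N) {X u -` {y} \<inter> space N | u y. 0 \<le> u \<and> u \<le> t}"

locale birth_death_process = birth_death_rates E lam nu
  for E :: "nat set" and lam nu :: "nat \<Rightarrow> real" +
  fixes M :: "nat \<Rightarrow> 'w measure" and X :: "real \<Rightarrow> 'w \<Rightarrow> nat"
  assumes prob: "x \<in> E \<Longrightarrow> prob_space (M x)"
    and common_sets: "\<lbrakk>x \<in> E; y \<in> E\<rbrakk> \<Longrightarrow> sets (M x) = sets (M y)"
    and measurable_X: "\<lbrakk>x \<in> E; 0 \<le> t\<rbrakk> \<Longrightarrow> X t \<in> M x \<rightarrow>\<^sub>M count_space E"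
    and start: "x \<in> E \<Longrightarrow> AE w in M x. X 0 w = x"
    and right_continuous:
      "x \<in> E \<Longrightarrow> AE w in M x. \<forall>t\<ge>0. continuous (at_right t) (\<lambda>u. X u w)"
    and Markov_property:
      "\<lbrakk>x \<in> E; y \<in> E; 0 \<le> s; 0 \<le> t\<rbrakk> \<Longrightarrow>
         AE w in M x.
           real_cond_exp (M x) (history (M x) X s)
             (indicator {v \<in> space (M x). X (s + t) v = y}) w
           = transition_prob M X t (X s w) y"
    and generator:
      "\<lbrakk>bounded (f ` E); x \<in> E\<rbrakk> \<Longrightarrow>
         ((\<lambda>h. (semigroup_of M X h f x - f x) / h) \<longlongrightarrow> bd_generator lam nu f x) (at_right 0)"

text \<open>
  No explosion: almost surely only finitely many jumps in every bounded time interval.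
  A path that is right-continuous in the discrete space \<^typ>\<open>nat\<close> jumps exactly at its
  points of discontinuity.
\<close>

definition non_explosive ::
    "nat set \<Rightarrow> (nat \<Rightarrow> 'w measure) \<Rightarrow> (real \<Rightarrow> 'w \<Rightarrow> nat) \<Rightarrow> bool" where
  "non_explosive E M X \<longleftrightarrow>
     (\<forall>x\<in>E. AE w in M x. \<forall>T. finite {t. 0 < t \<and> t \<le> T \<and> \<not> isCont (\<lambda>u. X u w) t})"

definition stationary_distribution ::
    "nat set \<Rightarrow> (nat \<Rightarrow> 'w measure) \<Rightarrow> (real \<Rightarrow> 'w \<Rightarrow> nat) \<Rightarrow> nat pmf \<Rightarrow> bool" where
  "stationary_distribution E M X \<pi> \<longleftrightarrow>
     set_pmf \<pi> \<subseteq> E \<and>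
     (\<forall>t\<ge>0. \<forall>y\<in>E. ((\<lambda>x. pmf \<pi> x * transition_prob M X t x y) has_sum pmf \<pi> y) E)"

end

theory Submission
  imports Defs
begin

text \<open>
  The condition says that the drift \<open>lam - nu\<close> decreases at rate \<open>K\<close>. Hence the drift grows at most
  linearly and \<open>y + 1\<close> is a Lyapunov function, which gives first moments for the transition
  kernels and a term dominating all bounded functions at infinity. For bounded \<open>f\<close>, the
  function \<open>P\<^sub>t f x - P\<^sub>t f y - L exp (- K t) (x - y)\<close>, perturbed by a small multiple of
  the Lyapunov function, satisfies a maximum principle on the pairs \<open>y \<le> x\<close>; this is
  the comparison argument for two independent copies of the process. Lipschitz \<open>f\<close> are truncated.
\<close>

section \<open>A maximum principle driven by right derivatives\<close>

text \<open>Let \<open>\<tau>\<close> be the infimum of the times at which \<open>F\<close> is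
  positive somewhere on \<open>A\<close>. By continuity \<open>F\<close> is still nonpositive at
  \<open>\<tau>\<close>, and just after \<open>\<tau>\<close> no point of the finite set
  \<open>A\<close> can become positive: zeros are pushed down by the derivative, and negative values
  stay negative. So positivity cannot begin at \<open>\<tau>\<close>.\<close>

lemma nonpos_if_right_derivative_neg_at_zeros:
  fixes F :: "real \<Rightarrow> 'a \<Rightarrow> real"
  assumes fin: "finite A" and sub: "A \<subseteq> S"
    and cont: "\<And>x. x \<in> A \<Longrightarrow> continuous_on {0..} (\<lambda>t. F t x)"
    and init: "\<And>x. x \<in> S \<Longrightarrow> F 0 x \<le> 0"
    and outside: "\<And>t x. 0 \<le> t \<Longrightarrow> x \<in> S - A \<Longrightarrow> F t x \<le> 0"
    and deriv: "\<And>t x. \<lbrakk>0 \<le> t; x \<in> A; F t x = 0; \<And>y. y \<in> S \<Longrightarrow> F t y \<le> 0\<rbrakk>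
                  \<Longrightarrow> \<exists>D<0. ((\<lambda>s. F s x) has_real_derivative D) (at_right t)"
    and t: "0 \<le> t" and x: "x \<in> S"
  shows "F t x \<le> 0"
proof (rule ccontr)
  assume neg: "\<not> F t x \<le> 0"
  define B where "B = {s. 0 \<le> s \<and> (\<exists>y\<in>A. 0 < F s y)}"
  have tB: "t \<in> B"
    using neg t x outside[OF t, of x] by (cases "x \<in> A") (auto simp: B_def not_le)
  have bdd: "bdd_below B"
    by (auto simp: B_def intro!: bdd_belowI[of _ 0])
  define \<tau> where "\<tau> = Inf B"
  have \<tau>0: "0 \<le> \<tau>"
    unfolding \<tau>_def using tB by (intro cInf_greatest) (auto simp: B_def)
  have before: "F s y \<le> 0" if "0 \<le> s" "s < \<tau>" "y \<in> A" for s y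
    using cInf_lower[OF _ bdd, of s] that by (force simp: \<tau>_def B_def)
  have at_A: "F \<tau> y \<le> 0" if y: "y \<in> A" for y
  proof (cases "\<tau> = 0")
    case True
    then show ?thesis using init y sub by auto
  next
    case False
    with \<tau>0 have pos: "0 < \<tau>" by simp
    have "((\<lambda>s. F s y) \<longlongrightarrow> F \<tau> y) (at \<tau> within {0..})"
      using cont[OF y] \<tau>0 by (simp add: continuous_on_def)
    then have "((\<lambda>s. F s y) \<longlongrightarrow> F \<tau> y) (at \<tau> within {0..\<tau>})"
      by (rule tendsto_within_subset) auto
    then have lim: "((\<lambda>s. F s y) \<longlongrightarrow> F \<tau> y) (at_left \<tau>)"
      using pos by (simp add: at_within_Icc_at_left)
    have "\<forall>\<^sub>F s in at_left \<tau>. F s y \<le> 0"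
      using eventually_at_left_real[OF pos] by eventually_elim (auto intro: before y)
    then show ?thesis
      using lim by (intro tendsto_upperbound[OF lim]) auto
  qed
  then have at_S: "F \<tau> y \<le> 0" if "y \<in> S" for y
    using that outside[OF \<tau>0, of y] by auto
  have "\<forall>\<^sub>F s in at_right \<tau>. F s y \<le> 0" if y: "y \<in> A" for y
  \<comment> \<open>The derivative condition is available only at zeros; at strictly negative values
    continuity from the right suffices.\<close>
  proof (cases "F \<tau> y = 0")
    case True
    obtain D where D: "D < 0" and der: "((\<lambda>s. F s y) has_real_derivative D) (at_right \<tau>)"
      using deriv[OF \<tau>0 y True at_S] by blast
    have "\<forall>\<^sub>F s in at_right \<tau>. (F s y - F \<tau> y) / (s - \<tau>) < 0"
      using der D by (intro order_tendstoD(2)[of _ D]) (auto simp: has_field_derivative_iff)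
    then show ?thesis
      using eventually_at_right_less[of \<tau>]
      by eventually_elim (use True in \<open>auto simp: divide_less_0_iff\<close>)
  next
    case False
    have "((\<lambda>s. F s y) \<longlongrightarrow> F \<tau> y) (at \<tau> within {0..})"
      using cont[OF y] \<tau>0 by (simp add: continuous_on_def)
    then have "((\<lambda>s. F s y) \<longlongrightarrow> F \<tau> y) (at_right \<tau>)"
      by (rule tendsto_within_subset) (use \<tau>0 in auto)
    then have "\<forall>\<^sub>F s in at_right \<tau>. F s y < 0"
      using False at_A[OF y] by (intro order_tendstoD(2)) auto
    then show ?thesis by eventually_elim simp
  qed
  \<comment> \<open>Finiteness of \<open>A\<close> yields one right neighbourhood of
    \<open>\<tau>\<close> that serves all its points; this contradicts
    \<open>\<tau> = Inf B\<close>.\<close>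
  then have "\<forall>\<^sub>F s in at_right \<tau>. \<forall>y\<in>A. F s y \<le> 0"
    using fin by (simp add: eventually_ball_finite_distrib)
  then obtain b where b: "\<tau> < b" "\<And>s. \<tau> < s \<Longrightarrow> s < b \<Longrightarrow> \<forall>y\<in>A. F s y \<le> 0"
    by (auto simp: eventually_at_right_field)
  have "b \<le> s" if s: "s \<in> B" for s
  proof (rule ccontr)
    assume "\<not> b \<le> s"
    moreover have "\<tau> \<le> s"
      unfolding \<tau>_def using s bdd by (rule cInf_lower)
    ultimately have "\<forall>y\<in>A. F s y \<le> 0"
      using b(2)[of s] at_A by (cases "s = \<tau>") auto
    with s show False by (auto simp: B_def)
  qed
  then have "b \<le> \<tau>"
    unfolding \<tau>_def using tB by (intro cInf_greatest) auto
  with b(1) show False by simp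
qed

section \<open>Expectations of bounded functions and Lipschitz bounds\<close>

lemma expectation_bounded:
  fixes f :: "'a \<Rightarrow> real"
  assumes "\<And>y. \<bar>f y\<bar> \<le> B"
  shows "\<bar>measure_pmf.expectation p f\<bar> \<le> B"
proof -
  have "integrable (measure_pmf p) f"
    using assms by (intro measure_pmf.integrable_const_bound[of _ B]) auto
  then show ?thesis
    using measure_pmf.integral_le_const[of p f B] measure_pmf.integral_ge_const[of p f "-B"] assms
    by (auto simp: abs_le_iff minus_le_iff)
qed

text \<open>Adding \<open>B\<close> makes \<open>h\<close> nonnegative, so the rule for nonnegative
  integrals over \<open>bind_pmf\<close> applies; the constant cancels at the end.\<close>

lemma expectation_bind_pmf_bounded:
  fixes h :: "'b \<Rightarrow> real"
  assumes h: "\<And>y. \<bar>h y\<bar> \<le> B"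
  shows "measure_pmf.expectation (bind_pmf p q) h =
         measure_pmf.expectation p (\<lambda>x. measure_pmf.expectation (q x) h)"
proof -
  have int: "integrable (measure_pmf r) h" for r :: "'b pmf"
    using h by (intro measure_pmf.integrable_const_bound[of _ B]) auto
  have nonneg: "0 \<le> h y + B" for y
    using h[of y] by simp
  have bnd: "\<bar>measure_pmf.expectation r h\<bar> \<le> B" for r :: "'b pmf"
    by (rule expectation_bounded[OF h])
  have int': "integrable (measure_pmf p) (\<lambda>x. measure_pmf.expectation (q x) h)"
    using bnd by (intro measure_pmf.integrable_const_bound[of _ B]) auto
  have nn: "(\<integral>\<^sup>+ y. ennreal (h y + B) \<partial>measure_pmf r) = ennreal (measure_pmf.expectation r h + B)"
    for r :: "'b pmf"
    using nonneg int by (subst nn_integral_eq_integral) auto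
  have bnd': "0 \<le> measure_pmf.expectation r h + B" for r :: "'b pmf"
    using bnd[of r] by simp
  have "ennreal (measure_pmf.expectation (bind_pmf p q) h + B)
      = (\<integral>\<^sup>+ x. ennreal (measure_pmf.expectation (q x) h + B) \<partial>measure_pmf p)"
    by (simp only: nn[symmetric] nn_integral_bind_pmf)
  also have "\<dots> = ennreal (measure_pmf.expectation p (\<lambda>x. measure_pmf.expectation (q x) h) + B)"
    using bnd' int' by (subst nn_integral_eq_integral) auto
  finally show ?thesis
    using bnd' int' integral_nonneg_AE[of "\<lambda>x. measure_pmf.expectation (q x) h + B" "measure_pmf p"]
    by (subst (asm) ennreal_inj) auto
qed

text \<open>The whole type is countable, so almost every point has positive mass, which is the
  defining condition of a mass function.\<close>

lemma Abs_pmf_inverse_nat: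
  fixes N :: "nat measure"
  assumes "prob_space N" "sets N = UNIV"
  shows "measure_pmf (Abs_pmf N) = N"
proof (rule Abs_pmf_inverse)
  interpret prob_space N by fact
  show "N \<in> {M. prob_space M \<and> sets M = UNIV \<and> (AE x in M. measure M {x} \<noteq> 0)}"
    using assms AE_support_countable by (auto intro!: exI[of _ UNIV])
qed

lemma Lip_bound:
  assumes f: "f \<in> Lip d E" and xy: "x \<in> E" "y \<in> E" "x \<noteq> y" and d: "0 < d x y"
  shows "\<bar>f x - f y\<bar> \<le> enn2real (lip_norm d E f) * d x y"
proof -
  have "ennreal (\<bar>f x - f y\<bar> / d x y) \<le> lip_norm d E f"
    unfolding lip_norm_def using xy by (intro SUP_upper2[of "(x, y)"]) auto
  also have "\<dots> = ennreal (enn2real (lip_norm d E f))"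
    using f by (simp add: Lip_def)
  finally show ?thesis
    using d by (simp add: field_simps)
qed

section \<open>Transition kernels and the semigroup law\<close>

context birth_death_process
begin

text \<open>As mass functions the kernels compose by \<open>bind_pmf\<close>, and measurability on
  \<open>nat\<close> is automatic. The value is meaningful only for \<open>x \<in> E\<close> and
  \<open>0 \<le> t\<close>, where the distribution is a probability measure.\<close>

definition trans_pmf :: "real \<Rightarrow> nat \<Rightarrow> nat pmf" where
  "trans_pmf t x = Abs_pmf (distr (M x) (count_space UNIV) (X t))"

lemma measurable_X_UNIV: "x \<in> E \<Longrightarrow> 0 \<le> t \<Longrightarrow> X t \<in> M x \<rightarrow>\<^sub>M count_space UNIV"
  using measurable_comp[OF measurable_X, of x t "\<lambda>y. y" "count_space UNIV"] by (simp add: comp_def)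

lemma measure_trans_pmf:
  assumes "x \<in> E" "0 \<le> t"
  shows "measure_pmf (trans_pmf t x) = distr (M x) (count_space UNIV) (X t)"
  unfolding trans_pmf_def
  using assms prob measurable_X_UNIV
  by (intro Abs_pmf_inverse_nat) (auto intro!: prob_space.prob_space_distr)

lemma pmf_trans_pmf:
  assumes "x \<in> E" "0 \<le> t"
  shows "pmf (trans_pmf t x) y = transition_prob M X t x y"
  using assms measurable_X_UNIV
  by (simp add: pmf.rep_eq measure_trans_pmf measure_distr transition_prob_def vimage_def
      Int_def conj_commute)

lemma expectation_trans_pmf:
  assumes "x \<in> E" "0 \<le> t"
  shows "measure_pmf.expectation (trans_pmf t x) f = semigroup_of M X t f x"
  using assms measurable_X_UNIV
  by (simp add: measure_trans_pmf semigroup_of_def integral_distr)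

lemma set_trans_pmf:
  assumes "x \<in> E" "0 \<le> t"
  shows "set_pmf (trans_pmf t x) \<subseteq> E"
proof -
  have "AE y in measure_pmf (trans_pmf t x). y \<in> E"
    unfolding measure_trans_pmf[OF assms]
    using assms measurable_X_UNIV measurable_space[OF measurable_X]
    by (subst AE_distr_iff) auto
  then show ?thesis by (auto simp: AE_measure_pmf_iff)
qed

lemma subalgebra_history:
  assumes "x \<in> E"
  shows "subalgebra (M x) (history (M x) X s)"
proof -
  have "{X u -` {y} \<inter> space (M x) |u y. 0 \<le> u \<and> u \<le> s} \<subseteq> sets (M x)"
    using measurable_sets[OF measurable_X_UNIV[OF assms]] by auto
  moreover from this have "{X u -` {y} \<inter> space (M x) |u y. 0 \<le> u \<and> u \<le> s} \<subseteq> Pow (space (M x))"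
    using sets.space_closed by blast
  ultimately show ?thesis
    by (auto simp: subalgebra_def history_def space_measure_of sets_measure_of
        intro!: sets.sigma_sets_subset)
qed

text \<open>This is the integrated Markov property: the conditional probability given the history
  has the same integral as the indicator of the event, and it is a function of \<open>X s\<close>
  alone.\<close>

lemma Chapman_Kolmogorov:
  assumes x: "x \<in> E" and st: "0 \<le> s" "0 \<le> t"
  shows "trans_pmf (s + t) x = bind_pmf (trans_pmf s x) (trans_pmf t)"
proof (rule pmf_eqI)
  fix y
  interpret prob_space "M x" using x by (rule prob)
  interpret finite_measure_subalgebra "M x" "history (M x) X s"
    by unfold_locales (rule subalgebra_history[OF x])
  let ?g = "indicator {v \<in> space (M x). X (s + t) v = y} :: 'w \<Rightarrow> real"
  note X_meas = measurable_X_UNIV[OF x]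
  have ev: "{v \<in> space (M x). X (s + t) v = y} \<in> sets (M x)"
    using measurable_sets[OF X_meas[of "s + t"], of "{y}"] st by (simp add: vimage_def Int_def conj_commute)
  show "pmf (trans_pmf (s + t) x) y = pmf (bind_pmf (trans_pmf s x) (trans_pmf t)) y"
  proof (cases "y \<in> E")
    case True
    have "pmf (trans_pmf (s + t) x) y = (\<integral>w. ?g w \<partial>M x)"
      using x st ev by (simp add: pmf_trans_pmf transition_prob_def)
    also have "\<dots> = (\<integral>w. real_cond_exp (M x) (history (M x) X s) ?g w \<partial>M x)"
      using ev by (intro real_cond_exp_int(2)[symmetric]) (simp add: integrable_indicator_iff less_top[symmetric])
    also have "\<dots> = (\<integral>w. pmf (trans_pmf t (X s w)) y \<partial>M x)"
    proof (rule integral_cong_AE)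
      show "(\<lambda>w. pmf (trans_pmf t (X s w)) y) \<in> borel_measurable (M x)"
        using measurable_compose[OF X_meas[OF st(1)], of "\<lambda>z. pmf (trans_pmf t z) y"] by simp
      show "AE w in M x. real_cond_exp (M x) (history (M x) X s) ?g w = pmf (trans_pmf t (X s w)) y"
        using Markov_property[OF x True st] AE_space
        by eventually_elim (use st x measurable_space[OF measurable_X] in \<open>auto simp: pmf_trans_pmf\<close>)
    qed simp
    also have "\<dots> = pmf (bind_pmf (trans_pmf s x) (trans_pmf t)) y"
      using x st X_meas by (simp add: pmf_bind measure_trans_pmf integral_distr)
    finally show ?thesis .
  next
    \<comment> \<open>The Markov property speaks only of targets in \<open>E\<close>; elsewhere both
      masses vanish because the kernels are carried by \<open>E\<close>.\<close>
    case False
    moreover have "set_pmf (trans_pmf (s + t) x) \<subseteq> E"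
      using x st by (intro set_trans_pmf) auto
    moreover have "set_pmf (bind_pmf (trans_pmf s x) (trans_pmf t)) \<subseteq> E"
      unfolding set_bind_pmf using set_trans_pmf[OF x st(1)] set_trans_pmf[OF _ st(2)] by blast
    ultimately have "y \<notin> set_pmf (trans_pmf (s + t) x)"
      "y \<notin> set_pmf (bind_pmf (trans_pmf s x) (trans_pmf t))"
      by blast+
    then show ?thesis unfolding set_pmf_iff by simp
  qed
qed

lemma expectation_Chapman_Kolmogorov:
  fixes f :: "nat \<Rightarrow> real"
  assumes "x \<in> E" "0 \<le> s" "0 \<le> h" "\<And>y. \<bar>f y\<bar> \<le> B"
  shows "measure_pmf.expectation (trans_pmf (s + h) x) f =
         semigroup_of M X h (\<lambda>z. measure_pmf.expectation (trans_pmf s z) f) x"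
  using assms
  by (simp add: add.commute[of s h] Chapman_Kolmogorov expectation_bind_pmf_bounded[of f B]
      expectation_trans_pmf)

section \<open>Backward equation and continuity in time\<close>

text \<open>Running the process first for the short time \<open>h\<close> gives
  \<open>u (s + h)\<close> as the semigroup at time \<open>h\<close> applied to \<open>u s\<close>.
  Since \<open>u s\<close> is bounded, the generator assumption at time 0 applies to it, and it
  yields a derivative from the right.\<close>

lemma backward_equation:
  fixes f :: "nat \<Rightarrow> real"
  assumes x: "x \<in> E" and s: "0 \<le> s" and B: "\<And>y. \<bar>f y\<bar> \<le> B"
  defines "u \<equiv> \<lambda>t x. measure_pmf.expectation (trans_pmf t x) f"
  shows "((\<lambda>t. u t x) has_real_derivative bd_generator lam nu (u s) x) (at_right s)"
proof -
  have "bounded (u s ` E)"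
    using expectation_bounded[of f B] B by (auto simp: u_def bounded_iff)
  from generator[OF this x]
  have "((\<lambda>h. (u (s + h) x - u s x) / h) \<longlongrightarrow> bd_generator lam nu (u s) x) (at_right 0)"
  proof (rule Lim_transform_eventually)
    show "\<forall>\<^sub>F h in at_right 0. (semigroup_of M X h (u s) x - u s x) / h = (u (s + h) x - u s x) / h"
      using eventually_at_right_less[of 0] unfolding u_def
      by eventually_elim (simp add: expectation_Chapman_Kolmogorov[OF x s _ B])
  qed
  then show ?thesis
    by (simp add: has_field_derivative_iff filterlim_at_right_to_0[of _ _ s] add.commute)
qed

text \<open>The difference quotient of the indicator of \<open>x\<close> has a finite limit, so its
  product with \<open>h\<close> tends to 0.\<close>

lemma return_probability_tendsto_1:
  assumes x: "x \<in> E"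
  shows "((\<lambda>h. pmf (trans_pmf h x) x) \<longlongrightarrow> 1) (at_right 0)"
proof -
  let ?f = "indicator {x} :: nat \<Rightarrow> real"
  have "bounded (?f ` E)"
    by (rule finite_imp_bounded, rule finite_subset[of _ "{0, 1}"]) (auto simp: indicator_def)
  from generator[OF this x]
  have "((\<lambda>h. h * ((semigroup_of M X h ?f x - ?f x) / h) + 1) \<longlongrightarrow>
      0 * bd_generator lam nu ?f x + 1) (at_right 0)"
    by (intro tendsto_intros)
  then have "((\<lambda>h. h * ((semigroup_of M X h ?f x - ?f x) / h) + 1) \<longlongrightarrow> 1) (at_right 0)"
    by simp
  then show ?thesis
  proof (rule Lim_transform_eventually)
    show "\<forall>\<^sub>F h in at_right 0. h * ((semigroup_of M X h ?f x - ?f x) / h) + 1 = pmf (trans_pmf h x) x"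
      using eventually_at_right_less[of 0]
      by eventually_elim (use x in \<open>simp add: expectation_trans_pmf[symmetric] pmf.rep_eq\<close>)
  qed
qed

text \<open>Run the process first for time \<open>h\<close>. If it is then at \<open>x\<close>, the
  increment is 0; otherwise it is at most \<open>2 * B\<close>. The bound does not depend on
  \<open>s\<close>.\<close>

lemma expectation_increment_le:
  fixes f :: "nat \<Rightarrow> real"
  assumes x: "x \<in> E" and s: "0 \<le> s" "0 \<le> h" and B: "\<And>y. \<bar>f y\<bar> \<le> B"
  shows "\<bar>measure_pmf.expectation (trans_pmf (s + h) x) f - measure_pmf.expectation (trans_pmf s x) f\<bar>
         \<le> 2 * B * (1 - pmf (trans_pmf h x) x)"
proof -
  define v where "v = (\<lambda>z. measure_pmf.expectation (trans_pmf s z) f)"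
  have v: "\<bar>v z\<bar> \<le> B" for z
    unfolding v_def by (rule expectation_bounded[OF B])
  let ?p = "measure_pmf (trans_pmf h x)"
  have int: "integrable ?p v"
    using v by (intro measure_pmf.integrable_const_bound[of _ B]) auto
  have "measure_pmf.expectation (trans_pmf (s + h) x) f - v x = (\<integral>z. v z - v x \<partial>?p)"
    using int x s by (simp add: expectation_Chapman_Kolmogorov[OF x s B] v_def[symmetric]
        expectation_trans_pmf[symmetric])
  also have "\<bar>\<dots>\<bar> \<le> (\<integral>z. \<bar>v z - v x\<bar> \<partial>?p)"
    by (rule integral_abs_bound)
  also have "\<dots> \<le> (\<integral>z. 2 * B * (1 - indicator {x} z) \<partial>?p)"
  proof (rule integral_mono)
    show "\<bar>v z - v x\<bar> \<le> 2 * B * (1 - indicator {x} z)" for z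
      using v[of z] v[of x] by (auto simp: indicator_def)
    show "integrable ?p (\<lambda>z. \<bar>v z - v x\<bar>)"
      using int by simp
    show "integrable ?p (\<lambda>z. 2 * B * (1 - indicator {x} z))"
      by (intro integrable_mult_right integrable_diff) (auto intro!: measure_pmf.integrable_const_bound[of _ 1])
  qed
  also have "\<dots> = 2 * B * (1 - pmf (trans_pmf h x) x)"
    by (subst integral_mult_right_zero, subst Bochner_Integration.integral_diff)
      (auto simp: pmf.rep_eq intro!: measure_pmf.integrable_const_bound[of _ 1])
  finally show ?thesis by (simp add: v_def)
qed

lemma continuous_on_expectation:
  fixes f :: "nat \<Rightarrow> real"
  assumes x: "x \<in> E" and B: "\<And>y. \<bar>f y\<bar> \<le> B"
  shows "continuous_on {0..} (\<lambda>t. measure_pmf.expectation (trans_pmf t x) f)"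
proof -
  let ?u = "\<lambda>t. measure_pmf.expectation (trans_pmf t x) f"
  have lim: "((\<lambda>h. 2 * B * (1 - pmf (trans_pmf h x) x)) \<longlongrightarrow> 2 * B * (1 - 1)) (at_right 0)"
    by (intro tendsto_intros return_probability_tendsto_1 x)
  show ?thesis
    unfolding continuous_on_iff
  proof (intro ballI allI impI)
    fix t e :: real assume t: "t \<in> {0..}" and e: "0 < e"
    have "\<forall>\<^sub>F h in at_right 0. 2 * B * (1 - pmf (trans_pmf h x) x) < e"
      using lim e by (intro order_tendstoD(2)[OF lim]) auto
    then obtain b where b: "0 < b" "\<And>h. 0 < h \<Longrightarrow> h < b \<Longrightarrow> 2 * B * (1 - pmf (trans_pmf h x) x) < e"
      by (auto simp: eventually_at_right_field)
    \<comment> \<open>The increment bound starts from the smaller of the two times and is uniform in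
      it, so the same \<open>b\<close> controls both sides of \<open>t\<close>.\<close>
    have main: "\<bar>?u r - ?u s\<bar> < e" if "0 \<le> s" "s < r" "r - s < b" for r s
      using expectation_increment_le[OF x, of s "r - s" f B] B b(2)[of "r - s"] that by fastforce
    show "\<exists>d>0. \<forall>t'\<in>{0..}. dist t' t < d \<longrightarrow> dist (?u t') (?u t) < e"
    proof (intro exI[of _ b] conjI ballI impI b(1))
      fix t' :: real assume t': "t' \<in> {0..}" "dist t' t < b"
      show "dist (?u t') (?u t) < e"
        using main[of t t'] main[of t' t] t t' e
        by (cases t t' rule: linorder_cases) (auto simp: dist_real_def abs_minus_commute)
    qed
  qed
qed

lemma expectation_at_0:
  fixes f :: "nat \<Rightarrow> real"
  assumes "x \<in> E"
  shows "measure_pmf.expectation (trans_pmf 0 x) f = f x"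
proof -
  interpret prob_space "M x" using assms by (rule prob)
  have "semigroup_of M X 0 f x = (\<integral>w. f x \<partial>M x)"
    unfolding semigroup_of_def
  proof (rule integral_cong_AE)
    show "(\<lambda>w. f (X 0 w)) \<in> borel_measurable (M x)"
      using measurable_compose[OF measurable_X_UNIV[OF assms order_refl], of f] by simp
    show "AE w in M x. f (X 0 w) = f x"
      using start[OF assms] by eventually_elim simp
  qed simp
  then show ?thesis using assms by (simp add: expectation_trans_pmf prob_space)
qed

end

section \<open>Algebra of the birth-death generator\<close>

lemma (in birth_death_rates) rates_nonneg: "x \<in> E \<Longrightarrow> 0 \<le> lam x" "x \<in> E \<Longrightarrow> 0 \<le> nu x"
  using birth_pos[of x] birth_top[of x] death_pos[of x] death_0
  by (cases "x + 1 \<in> E"; cases "x = 0"; force)+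

lemma (in birth_death_rates) zero_in_E: "0 \<in> E"
  using state_space by auto

lemma (in birth_death_rates) down_closed: "x \<in> E \<Longrightarrow> y \<le> x \<Longrightarrow> y \<in> E"
  using state_space by auto

text \<open>On affine functions only the drift is seen. At \<open>x = 0\<close> the truncated
  \<open>x - 1\<close> does no harm because \<open>nu 0 = 0\<close>.\<close>

lemma (in birth_death_rates) bd_generator_affine:
  "bd_generator lam nu (\<lambda>y. a * real y + b) x = a * (lam x - nu x)"
  using death_0 by (cases x) (auto simp: bd_generator_def algebra_simps)

text \<open>Jumps go to nearest neighbours, so a maximum among the neighbours inside
  \<open>E\<close> is enough; at the ends of \<open>E\<close> the rate of leaving is 0.\<close>

lemma (in birth_death_rates) bd_generator_le_at_max:
  assumes "x \<in> E"
    and "x + 1 \<in> E \<Longrightarrow> g (x + 1) \<le> g x" and "x \<noteq> 0 \<Longrightarrow> g (x - 1) \<le> g x"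
  shows "bd_generator lam nu g x \<le> 0"
proof -
  have "lam x * (g (x + 1) - g x) \<le> 0"
    using assms birth_top[of x] rates_nonneg[of x]
    by (cases "x + 1 \<in> E") (auto intro: mult_nonneg_nonpos)
  moreover have "nu x * (g (x - 1) - g x) \<le> 0"
    using assms death_0 rates_nonneg[of x]
    by (cases "x = 0") (auto intro: mult_nonneg_nonpos)
  ultimately show ?thesis by (simp add: bd_generator_def)
qed

lemma bd_generator_diff:
  "bd_generator lam nu (\<lambda>y. g y - h y) x = bd_generator lam nu g x - bd_generator lam nu h x"
  by (simp add: bd_generator_def algebra_simps)

section \<open>Drift bounds and first moments\<close>

locale dissipative_birth_death_process = birth_death_process E lam nu M X
  for E lam nu and M :: "nat \<Rightarrow> 'w measure" and X +
  fixes K :: real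
  assumes rate_gap: "x \<in> E \<Longrightarrow> x \<noteq> 0 \<Longrightarrow> K \<le> lam (x - 1) - lam x + nu x - nu (x - 1)"
begin

text \<open>\<open>rate_gap\<close> bounds the decrease of \<open>lam - nu\<close> over one step
  from below by \<open>K\<close>; summing from \<open>y\<close> to \<open>x\<close>
  telescopes.\<close>

lemma drift_diff_le:
  assumes "x \<in> E" "y \<le> x"
  shows "(lam x - nu x) - (lam y - nu y) \<le> - K * (real x - real y)"
  using assms(2,1)
proof (induction rule: dec_induct)
  case (step n)
  then have "n \<in> E" using down_closed by (metis le_SucI order_refl)
  with step rate_gap[of "Suc n"] show ?case by (auto simp: algebra_simps)
qed simp

text \<open>\<open>lam 0\<close> is the drift at 0 and the absolute value covers negative
  \<open>K\<close>. The summand 1 makes the growth bound strict, as the maximum principle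
  demands.\<close>

definition growth_rate :: real where
  "growth_rate = lam 0 + \<bar>K\<bar> + 1"

lemma growth_rate_pos: "0 < growth_rate"
  using rates_nonneg(1)[OF zero_in_E] by (simp add: growth_rate_def)

lemma drift_less:
  assumes "x \<in> E"
  shows "lam x - nu x < growth_rate * (real x + 1)"
proof -
  have "lam x - nu x \<le> lam 0 - K * real x"
    using drift_diff_le[OF assms, of 0] death_0 by simp
  also have "\<dots> \<le> lam 0 + \<bar>K\<bar> * real x"
    using mult_right_mono[of "- K" "\<bar>K\<bar>" "real x"] by simp
  also have "\<dots> < growth_rate * (real x + 1)"
    using rates_nonneg(1)[OF zero_in_E]
    by (simp add: growth_rate_def algebra_simps add_nonneg_pos add_pos_nonneg)
  finally show ?thesis .
qed

text \<open>The generator assumption covers bounded functions only, so \<open>y + 1\<close> is cut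
  off at \<open>N\<close> and compared with \<open>exp (growth_rate * t) * (x + 1)\<close>. The
  resulting bound is independent of \<open>N\<close>.\<close>

lemma expectation_truncated_growth:
  assumes x: "x \<in> E" and t: "0 \<le> t"
  shows "measure_pmf.expectation (trans_pmf t x) (\<lambda>y. min (real y + 1) (real N))
         \<le> exp (growth_rate * t) * (real x + 1)"
proof -
  let ?C = growth_rate
  let ?f = "\<lambda>y. min (real y + 1) (real N)"
  define u where "u = (\<lambda>t x. measure_pmf.expectation (trans_pmf t x) ?f)"
  \<comment> \<open>The subtracted term is expanded to the form \<open>a * real x + b\<close> that
    \<open>bd_generator_affine\<close> expects.\<close>
  define F where "F = (\<lambda>t x. u t x - (exp (?C * t) * real x + exp (?C * t)))"
  have B: "\<bar>?f y\<bar> \<le> real N" for y by auto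
  have exp_ge: "1 \<le> exp (?C * s)" if "0 \<le> s" for s
    using that growth_rate_pos by simp
  have "F t x \<le> 0"
  proof (rule nonpos_if_right_derivative_neg_at_zeros[where F = F and A = "E \<inter> {..N}" and S = E])
    show "continuous_on {0..} (\<lambda>t. F t x)" if "x \<in> E \<inter> {..N}" for x
      using that unfolding F_def u_def
      by (intro continuous_intros continuous_on_expectation[OF _ B]) auto
    show "F 0 x \<le> 0" if "x \<in> E" for x
      using that by (simp add: F_def u_def expectation_at_0)
    \<comment> \<open>Above \<open>N\<close> the cutoff value \<open>N\<close> already lies below
      \<open>x + 1\<close>, which leaves finitely many states to examine.\<close>
    show "F s x \<le> 0" if "0 \<le> s" "x \<in> E - (E \<inter> {..N})" for s x
    proof -
      have "u s x \<le> real N"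
        using expectation_bounded[of ?f, OF B, of "trans_pmf s x"] by (simp add: u_def)
      also have "\<dots> \<le> 1 * real x + 1" using that by auto
      also have "\<dots> \<le> exp (?C * s) * real x + exp (?C * s)"
        using exp_ge that by (intro add_mono mult_right_mono) auto
      finally show ?thesis by (simp add: F_def)
    qed
    show "\<exists>D<0. ((\<lambda>s. F s x) has_real_derivative D) (at_right s)"
      if s: "0 \<le> s" and x: "x \<in> E \<inter> {..N}" and eq: "F s x = 0"
        and le: "\<And>y. y \<in> E \<Longrightarrow> F s y \<le> 0" for s x
    proof (intro exI conjI)
      let ?D = "bd_generator lam nu (u s) x - (exp (?C * s) * ?C * real x + exp (?C * s) * ?C)"
      have "((\<lambda>t. u t x) has_real_derivative bd_generator lam nu (u s) x) (at_right s)"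
        unfolding u_def using x s by (intro backward_equation[OF _ _ B]) auto
      then show "((\<lambda>s. F s x) has_real_derivative ?D) (at_right s)"
        unfolding F_def by (auto intro!: derivative_eq_intros)
      \<comment> \<open>At a zero of \<open>F s\<close> the function attains its maximum over
        \<open>E\<close>.\<close>
      have "bd_generator lam nu (F s) x \<le> 0"
        using x eq le down_closed[of x "x - 1"] by (intro bd_generator_le_at_max) auto
      then have "bd_generator lam nu (u s) x \<le> exp (?C * s) * (lam x - nu x)"
        by (simp add: F_def bd_generator_diff bd_generator_affine)
      also have "\<dots> < exp (?C * s) * (?C * (real x + 1))"
        using drift_less x by simp
      finally show "?D < 0" by (simp add: algebra_simps)
    qed
  qed (use x t in auto)
  then show ?thesis by (simp add: F_def u_def algebra_simps)
qed

text \<open>Monotone convergence: the truncations increase to \<open>y + 1\<close>, and their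
  expectations are bounded uniformly in \<open>N\<close>.\<close>

lemma integrable_trans_pmf_affine:
  assumes x: "x \<in> E" and t: "0 \<le> t"
  shows "integrable (measure_pmf (trans_pmf t x)) (\<lambda>y. real y + 1)"
proof -
  let ?p = "measure_pmf (trans_pmf t x)"
  let ?f = "\<lambda>N y. min (real y + 1) (real N)"
  have int: "integrable ?p (?f N)" for N
    by (rule measure_pmf.integrable_const_bound[of _ "real N"]) auto
  have inc: "incseq (\<lambda>N. integral\<^sup>L ?p (?f N))"
    by (intro incseq_SucI integral_mono int) auto
  have "\<forall>N. integral\<^sup>L ?p (?f N) \<le> exp (growth_rate * t) * (real x + 1)"
    using expectation_truncated_growth[OF x t] by blast
  then obtain l where l: "(\<lambda>N. integral\<^sup>L ?p (?f N)) \<longlonglongrightarrow> l"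
    by (rule incseq_convergent[OF inc])
  have lim: "(\<lambda>N. ?f N y) \<longlonglongrightarrow> real y + 1" for y
    by (rule tendsto_eventually, rule eventually_sequentiallyI[of "y + 1"]) auto
  have "AE y in ?p. mono (\<lambda>N. ?f N y)"
    by (intro AE_I2 monoI min.mono) auto
  from integrable_monotone_convergence[OF int this _ l, of "\<lambda>y. real y + 1"] lim
  show ?thesis by simp
qed

text \<open>
  Two independent copies started at \<open>y < x\<close> cannot jump over each other, since jumps are to nearest
  neighbours; so the pairs \<open>y \<le> x\<close> are preserved up to the meeting time.
\<close>

lemma bounded_contraction:
  fixes f :: "nat \<Rightarrow> real"
  assumes B: "\<And>y. \<bar>f y\<bar> \<le> B" and L: "0 \<le> L"
    and lip: "\<And>x y. \<lbrakk>x \<in> E; y \<le> x\<rbrakk> \<Longrightarrow> f x - f y \<le> L * (real x - real y)"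
    and x: "x \<in> E" and y: "y \<le> x" and t: "0 \<le> t"
  shows "measure_pmf.expectation (trans_pmf t x) f - measure_pmf.expectation (trans_pmf t y) f
         \<le> L * exp (- K * t) * (real x - real y)"
proof -
  let ?C = growth_rate
  define u where "u = (\<lambda>t x. measure_pmf.expectation (trans_pmf t x) f)"
  define a where "a = (\<lambda>t. L * exp (- K * t))"
  have a_nonneg: "0 \<le> a s" for s using L by (simp add: a_def)
  have u_bound: "\<bar>u s z\<bar> \<le> B" for s z
    unfolding u_def by (rule expectation_bounded[OF B])
  \<comment> \<open>The term with \<open>\<epsilon>\<close> dominates the bounded difference of
    \<open>u\<close> for large \<open>x\<close>, makes the function strictly negative on the
    diagonal, and gives the strict sign of the derivative.\<close>
  have perturbed: "u t x - u t y - a t * (real x - real y) - \<epsilon> * exp (?C * t) * (real x + real y + 2) \<le> 0"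
    if \<epsilon>: "0 < \<epsilon>" for \<epsilon>
  proof -
    define c where "c = (\<lambda>t. \<epsilon> * exp (?C * t))"
    have c_ge: "\<epsilon> \<le> c s" if "0 \<le> s" for s
      using that \<epsilon> growth_rate_pos by (simp add: c_def)
    have c_pos: "0 < c s" for s using \<epsilon> by (simp add: c_def)
    define S where "S = {(x, y). x \<in> E \<and> y \<le> x}"
    \<comment> \<open>For \<open>x\<close> above this threshold
      \<open>\<epsilon> * (x + y + 2)\<close> is at least \<open>2 * B\<close>, the largest possible
      difference of two values of \<open>u s\<close>.\<close>
    define m where "m = nat \<lceil>2 * B / \<epsilon>\<rceil>"
    define F where "F = (\<lambda>t (x, y). u t x - u t y - a t * (real x - real y) - c t * (real x + real y + 2))"
    have "F t (x, y) \<le> 0"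
    proof (rule nonpos_if_right_derivative_neg_at_zeros[where F = F and A = "S \<inter> {..m} \<times> {..m}" and S = S])
      show "continuous_on {0..} (\<lambda>t. F t z)" if "z \<in> S \<inter> {..m} \<times> {..m}" for z
        using that down_closed unfolding F_def u_def a_def c_def S_def
        by (auto intro!: continuous_intros continuous_on_expectation[OF _ B])
      show "F 0 z \<le> 0" if z: "z \<in> S" for z
      proof -
        obtain x y where [simp]: "z = (x, y)" by force
        have "x \<in> E" "y \<le> x" "y \<in> E" using z down_closed by (auto simp: S_def)
        moreover have "0 \<le> c 0 * (real x + real y + 2)"
          using c_pos[of 0] by simp
        ultimately show ?thesis
          using lip[of x y] by (simp add: F_def u_def expectation_at_0 a_def)
      qed
      show "F s z \<le> 0" if s: "0 \<le> s" and z: "z \<in> S - (S \<inter> {..m} \<times> {..m})" for s z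
      proof -
        obtain x y where [simp]: "z = (x, y)" by force
        have xy: "x \<in> E" "y \<le> x" "m < x" using z by (auto simp: S_def)
        have "2 * B / \<epsilon> \<le> real x + real y + 2" using xy(3) unfolding m_def by linarith
        then have "2 * B \<le> \<epsilon> * (real x + real y + 2)"
          using \<epsilon> by (simp add: field_simps)
        also have "\<dots> \<le> c s * (real x + real y + 2)"
          using c_ge[OF s] by (intro mult_right_mono) auto
        finally have "2 * B \<le> c s * (real x + real y + 2)" .
        moreover have "u s x - u s y \<le> 2 * B" using u_bound[of s x] u_bound[of s y] by simp
        moreover have "0 \<le> a s * (real x - real y)" using a_nonneg xy(2) by simp
        ultimately show ?thesis by (simp add: F_def)
      qed
      show "\<exists>D<0. ((\<lambda>s. F s z) has_real_derivative D) (at_right s)"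
        if s: "0 \<le> s" and z: "z \<in> S \<inter> {..m} \<times> {..m}" and eq: "F s z = 0"
          and le: "\<And>z. z \<in> S \<Longrightarrow> F s z \<le> 0" for s z
      proof -
        obtain x y where [simp]: "z = (x, y)" by force
        have xy: "x \<in> E" "y \<le> x" "y \<in> E" using z down_closed by (auto simp: S_def)
        \<comment> \<open>A zero of \<open>F s\<close> lies strictly off the diagonal, so moving
          either coordinate by one step inside \<open>E\<close> stays within
          \<open>S\<close>.\<close>
        have "y \<noteq> x"
          using eq c_pos[of s] by (auto simp: F_def)
        with xy have less: "y < x" by simp
        define D where "D = bd_generator lam nu (u s) x - bd_generator lam nu (u s) y
           + K * a s * (real x - real y) - ?C * c s * (real x + real y + 2)"
        have der: "((\<lambda>t. u t v) has_real_derivative bd_generator lam nu (u s) v) (at_right s)"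
          if "v \<in> E" for v
          unfolding u_def using that s by (intro backward_equation[OF _ _ B]) auto
        have "((\<lambda>s. F s z) has_real_derivative D) (at_right s)"
          unfolding F_def D_def a_def c_def
          using der[OF xy(1)] der[OF xy(3)] by (auto intro!: derivative_eq_intros simp: algebra_simps)
        moreover have "D < 0"
        proof -
          have "bd_generator lam nu (\<lambda>v. F s (v, y)) x \<le> 0"
            using le eq xy less down_closed[of x "x - 1"]
            by (intro bd_generator_le_at_max) (auto simp: S_def)
          moreover have "(\<lambda>v. F s (v, y)) =
              (\<lambda>v. u s v - ((a s + c s) * real v + (u s y - a s * real y + c s * (real y + 2))))"
            by (auto simp: F_def algebra_simps)
          ultimately have 1: "bd_generator lam nu (u s) x \<le> (a s + c s) * (lam x - nu x)"
            by (simp add: bd_generator_diff bd_generator_affine)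
          \<comment> \<open>Here \<open>u s\<close> enters with a minus sign, so the same maximum
            property bounds its generator at \<open>y\<close> from below.\<close>
          have "bd_generator lam nu (\<lambda>v. F s (x, v)) y \<le> 0"
            using le eq xy less
            by (intro bd_generator_le_at_max) (auto simp: S_def)
          moreover have "(\<lambda>v. F s (x, v)) =
              (\<lambda>v. ((a s - c s) * real v + (u s x - a s * real x - c s * (real x + 2))) - u s v)"
            by (auto simp: F_def algebra_simps)
          ultimately have 2: "(a s - c s) * (lam y - nu y) \<le> bd_generator lam nu (u s) y"
            by (simp add: bd_generator_diff bd_generator_affine)
          have 3: "a s * ((lam x - nu x) - (lam y - nu y)) \<le> a s * (- K * (real x - real y))"
            using drift_diff_le[OF xy(1,2)] a_nonneg by (rule mult_left_mono)
          have 4: "c s * ((lam x - nu x) + (lam y - nu y)) < c s * (?C * (real x + real y + 2))"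
            using drift_less[OF xy(1)] drift_less[OF xy(3)] c_pos[of s]
            by (intro mult_strict_left_mono) (auto simp: algebra_simps)
          \<comment> \<open>Subtracting 2 from 1 leaves \<open>a s\<close> times the difference of
            the drifts plus \<open>c s\<close> times their sum. By 3 and 4 these are outweighed by
            the two remaining terms of \<open>D\<close>, the derivatives of the exponential factors,
            with strictness from 4.\<close>
          from 1 2 3 4 show ?thesis
            by (simp add: D_def algebra_simps)
        qed
        ultimately show ?thesis by blast
      qed
    qed (use x y t in \<open>auto simp: S_def\<close>)
    then show ?thesis by (simp add: F_def c_def)
  qed
  have lim: "((\<lambda>\<epsilon>. u t x - u t y - a t * (real x - real y) - \<epsilon> * exp (?C * t) * (real x + real y + 2))
      \<longlongrightarrow> u t x - u t y - a t * (real x - real y) - 0 * exp (?C * t) * (real x + real y + 2)) (at_right 0)"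
    by (intro tendsto_intros)
  have "u t x - u t y - a t * (real x - real y) - 0 * exp (?C * t) * (real x + real y + 2) \<le> 0"
    using perturbed
    by (intro tendsto_upperbound[OF lim] eventually_mono[OF eventually_at_right_less]) auto
  then show ?thesis by (simp add: u_def a_def)
qed

section \<open>From bounded to Lipschitz functions\<close>

text \<open>Clipping \<open>f\<close> to the interval from \<open>-N\<close> to \<open>N\<close>
  does not increase its Lipschitz constant and makes it bounded. Dominated convergence, with the
  first moments of the kernels, carries the bounded estimate to the limit.\<close>

lemma lipschitz_contraction:
  fixes f :: "nat \<Rightarrow> real"
  assumes L: "0 \<le> L"
    and lip: "\<And>x y. \<lbrakk>x \<in> E; y \<in> E\<rbrakk> \<Longrightarrow> \<bar>f x - f y\<bar> \<le> L * \<bar>real x - real y\<bar>"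
    and x: "x \<in> E" and y: "y \<in> E" and t: "0 \<le> t"
  shows "\<bar>semigroup_of M X t f x - semigroup_of M X t f y\<bar>
         \<le> L * exp (- K * t) * \<bar>real x - real y\<bar>"
proof -
  define g where "g = (\<lambda>(N::nat) z. max (- real N) (min (real N) (f z)))"
  have g_bound: "\<bar>g N z\<bar> \<le> real N" for N z by (auto simp: g_def)
  have g_le: "\<bar>g N z\<bar> \<le> \<bar>f z\<bar>" for N z by (auto simp: g_def)
  have g_diff: "\<bar>g N z - g N w\<bar> \<le> \<bar>f z - f w\<bar>" for N z w by (auto simp: g_def)
  have g_lim: "(\<lambda>N. g N z) \<longlonglongrightarrow> f z" for z
  proof (rule tendsto_eventually)
    obtain m :: nat where "\<bar>f z\<bar> \<le> real m" using real_arch_simple by blast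
    then show "\<forall>\<^sub>F N in sequentially. g N z = f z"
      by (intro eventually_sequentiallyI[of m]) (auto simp: g_def)
  qed
  have conv: "(\<lambda>N. measure_pmf.expectation (trans_pmf t v) (g N)) \<longlonglongrightarrow> semigroup_of M X t f v"
    if v: "v \<in> E" for v
    unfolding expectation_trans_pmf[OF v t, symmetric]
  proof (rule integral_dominated_convergence)
    show "integrable (measure_pmf (trans_pmf t v)) (\<lambda>z. (\<bar>f 0\<bar> + L) * (real z + 1))"
      using integrable_trans_pmf_affine[OF v t] by simp
    show "AE z in measure_pmf (trans_pmf t v). norm (g N z) \<le> (\<bar>f 0\<bar> + L) * (real z + 1)" for N
    \<comment> \<open>The values of \<open>f\<close> outside \<open>E\<close> are arbitrary, so
      linear growth from \<open>f 0\<close> is claimed only on the support of the kernel.\<close>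
    proof (unfold AE_measure_pmf_iff, rule ballI)
      fix z assume "z \<in> set_pmf (trans_pmf t v)"
      then have "z \<in> E" using set_trans_pmf[OF v t] by blast
      then have "\<bar>f z\<bar> \<le> \<bar>f 0\<bar> + L * real z"
        using lip[of z 0] zero_in_E by simp
      also have "\<dots> \<le> (\<bar>f 0\<bar> + L) * (real z + 1)"
        using L by (simp add: algebra_simps)
      finally show "norm (g N z) \<le> (\<bar>f 0\<bar> + L) * (real z + 1)"
        using g_le[of N z] by simp
    qed
  qed (use g_lim in auto)
  have ordered: "\<bar>semigroup_of M X t f v - semigroup_of M X t f w\<bar>
      \<le> L * exp (- K * t) * (real v - real w)" if v: "v \<in> E" and w: "w \<le> v" for v w
  proof -
    have lip_ordered: "\<bar>g N z - g N r\<bar> \<le> L * (real z - real r)" if "z \<in> E" "r \<le> z" for N z r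
      using lip[of z r] g_diff[of N z r] that down_closed[of z r] by auto
    let ?e = "\<lambda>N v. measure_pmf.expectation (trans_pmf t v) (g N)"
    have "\<bar>?e N v - ?e N w\<bar> \<le> L * exp (- K * t) * (real v - real w)" for N
    proof -
      have "?e N v - ?e N w \<le> L * exp (- K * t) * (real v - real w)"
        using lip_ordered[of _ _ N]
        by (intro bounded_contraction[of _ "real N"] g_bound L v w t) (auto simp: abs_le_iff)
      \<comment> \<open>The one-sided estimate applied to \<open>- g N\<close> supplies the other
        half of the absolute value.\<close>
      moreover have "measure_pmf.expectation (trans_pmf t v) (\<lambda>z. - g N z)
          - measure_pmf.expectation (trans_pmf t w) (\<lambda>z. - g N z) \<le> L * exp (- K * t) * (real v - real w)"
        using lip_ordered[of _ _ N] g_bound[of N]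
        by (intro bounded_contraction[of _ "real N"] L v w t) (auto simp: abs_le_iff)
      ultimately show ?thesis by simp
    qed
    moreover have "(\<lambda>N. \<bar>?e N v - ?e N w\<bar>) \<longlonglongrightarrow>
        \<bar>semigroup_of M X t f v - semigroup_of M X t f w\<bar>"
      using conv v w down_closed[OF v w] by (intro tendsto_intros) auto
    ultimately show ?thesis
      by (intro LIMSEQ_le_const2) auto
  qed
  show ?thesis
    using ordered[of x y] ordered[of y x] x y by (cases "y \<le> x") (auto simp: abs_minus_commute)
qed

lemma wasserstein_curvature: "wasserstein_curvature_ge nat_dist E (semigroup_of M X) K"
  unfolding wasserstein_curvature_ge_def
proof (intro ballI allI impI)
  fix f t assume f: "f \<in> Lip nat_dist E" and t: "0 < (t::real)"
  define L where "L = enn2real (lip_norm nat_dist E f)"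
  have L: "0 \<le> L" "lip_norm nat_dist E f = ennreal L"
    using f by (auto simp: L_def Lip_def)
  have lip: "\<bar>f x - f y\<bar> \<le> L * \<bar>real x - real y\<bar>" if "x \<in> E" "y \<in> E" for x y
    using Lip_bound[OF f that] by (cases "x = y") (auto simp: L_def nat_dist_def)
  show "lip_norm nat_dist E (semigroup_of M X t f)
      \<le> ennreal (exp (- K * t)) * lip_norm nat_dist E f"
    unfolding lip_norm_def[of _ _ "semigroup_of M X t f"]
  proof (rule SUP_least, clarify)
    fix x y assume xy: "x \<in> E" "y \<in> E" "x \<noteq> y"
    then have "\<bar>semigroup_of M X t f x - semigroup_of M X t f y\<bar> / nat_dist x y \<le> exp (- K * t) * L"
      using lipschitz_contraction[OF L(1) lip xy(1,2), of t] t
      by (simp add: nat_dist_def divide_le_eq mult_ac)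
    then show "ennreal (\<bar>semigroup_of M X t f x - semigroup_of M X t f y\<bar> / nat_dist x y)
        \<le> ennreal (exp (- K * t)) * lip_norm nat_dist E f"
      using L by (simp add: ennreal_mult[symmetric])
  qed
qed

end

theorem proposition4p1:
  fixes E :: "nat set" and lam nu :: "nat \<Rightarrow> real"
    and M :: "nat \<Rightarrow> 'w measure" and X :: "real \<Rightarrow> 'w \<Rightarrow> nat"
    and \<pi> :: "nat pmf" and K :: real
  assumes "birth_death_process E lam nu M X"
    and "regular_rates E lam nu"
    and "non_explosive E M X"
    and "stationary_distribution E M X \<pi>"
    and "\<pi> \<in> finite_first_moment nat_dist E"
    and "(INF x\<in>E - {0}. ereal (lam (x - 1) - lam x + nu x - nu (x - 1))) \<ge> ereal K"
  shows "wasserstein_curvature_ge nat_dist E (semigroup_of M X) K"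
proof -
  interpret birth_death_process E lam nu M X by fact
  interpret dissipative_birth_death_process E lam nu M X K
    using assms(6) by unfold_locales (auto simp: le_INF_iff)
  show ?thesis by (rule wasserstein_curvature)
qed

end
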